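(* For every rational number $r\in[0,1]$ there exists a Liouville number in the unit interval whose finite-state dimension is equal to $r$.
   Context: A real number $\alpha$ in the unit interval is a Liouville number if for every positive integer $n$ there are integers $p>0$ and $q>1$ such that $0<\left|\alpha-\frac{p}{q}\right|<\frac{1}{q^n}$. Finite-state dimension. For a probability measure $\pi$ on a nonempty finite set $\Omega$, the Shannon entropy is $H(\pi)=\sum_{w\in\Omega}\pi(w)\log_2\frac{1}{\pi(w)}$, with $0\log_2\frac10=0$. Let $S=S[0]S[1]S[2]\dots$ be an infinite binary sequence. For positive integers $m,n$ and $w\in\{0,1\}^m$, let $$\pi^{(m)}_{S,n}(w)=\frac{1}{n}\left|\left\{t : 0\le t\le n-1,\ S[tm\dots (t+1)m-1]=w\right\}\right|,$$ the frequency of $w$ among the first $n$ consecutive disjoint blocks of length $m$ of $S$; this is a probability measure on $\{0,1\}^m$. Put $$H^-_m(S)=\frac1m\liminf_{n\to\infty}H\left(\pi^{(m)}_{S,n}\right),\qquad \dim_{\mathrm{FS}}(S)=\inf_{m\ge 1}H^-_m(S).$$ The finite-state dimension of a real number in the unit interval is $\dim_{\mathrm{FS}}(S)$, where $S$ is the sequence of digits after the point in its binary expansion. *)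

theory Defs
  imports "HOL-Analysis.Analysis"
begin

definition liouville_number :: "real \<Rightarrow> bool" where
  "liouville_number \<alpha> \<longleftrightarrow>
     (\<forall>n::nat. n > 0 \<longrightarrow> (\<exists>p q :: int. p > 0 \<and> q > 1 \<and>
        0 < \<bar>\<alpha> - of_int p / of_int q\<bar> \<and> \<bar>\<alpha> - of_int p / of_int q\<bar> < 1 / of_int q ^ n))"

text \<open>
  Probability measures on a finite set are represented by their mass functions.
  The convention 0 log(1/0) = 0 is automatic, since the term is a multiple of 0.
\<close>

definition shannon_entropy :: "'a set \<Rightarrow> ('a \<Rightarrow> real) \<Rightarrow> real" where
  "shannon_entropy \<Omega> \<pi> = (\<Sum>w\<in>\<Omega>. \<pi> w * log 2 (1 / \<pi> w))"

text \<open>The digits 0 and 1 are encoded as \<^const>\<open>False\<close> and \<^const>\<open>True\<close>.\<close>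

definition binary_words :: "nat \<Rightarrow> bool list set" where
  "binary_words m = {w. length w = m}"

definition block_frequency :: "nat \<Rightarrow> (nat \<Rightarrow> bool) \<Rightarrow> nat \<Rightarrow> bool list \<Rightarrow> real" where
  "block_frequency m S n w =
     real (card {t. t < n \<and> map S [t * m..<(t + 1) * m] = w}) / real n"

text \<open>
  Extended reals are used so that \<^const>\<open>liminf\<close> and \<^const>\<open>Inf\<close> are those of a
  complete lattice; the values lie between 0 and 1 for \<open>m \<ge> 1\<close>.
\<close>

definition lower_block_entropy :: "nat \<Rightarrow> (nat \<Rightarrow> bool) \<Rightarrow> ereal" where
  "lower_block_entropy m S =
     ereal (1 / real m) *
       liminf (\<lambda>n. ereal (shannon_entropy (binary_words m) (block_frequency m S n)))"

definition fs_dim_seq :: "(nat \<Rightarrow> bool) \<Rightarrow> ereal" where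
  "fs_dim_seq S = (INF m\<in>{1..}. lower_block_entropy m S)"

text \<open>
  Index 0 is the first digit after the point. Dyadic rationals in \<open>[0,1)\<close> get their terminating
  expansion and the number 1 gets the digits of 0; this choice does not affect the finite-state
  dimension, since all the alternative expansions are also eventually constant.
\<close>

definition binary_digits :: "real \<Rightarrow> nat \<Rightarrow> bool" where
  "binary_digits x k \<longleftrightarrow> odd \<lfloor>2 ^ (k + 1) * x\<rfloor>"

definition fs_dim :: "real \<Rightarrow> ereal" where
  "fs_dim x = fs_dim_seq (binary_digits x)"

end

theory Submission
  imports Defs "HOL-Real_Asymp.Real_Asymp"
begin

text \<open>
  For \<open>r = a / b > 0\<close> take the digit sequence that, on a sequence of rapidly growing stages, is
  periodic and runs through all binary words of length \<open>b * fact i\<close>, with every digit at a position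
  \<open>k\<close> with \<open>k mod b \<ge> a\<close> replaced by 0. Stopping a stage and continuing periodically gives
  the Liouville approximations. For each \<open>m\<close>, the frequencies of the \<open>m\<close>-blocks converge to the
  average over the phases \<open>j < b\<close> of the distributions of a block that starts at position
  \<open>j * m\<close> and has fair coin flips at its unmasked positions. The entropy of this mixture is at
  least the average of the entropies, which is \<open>a * m / b\<close>; for \<open>m = b\<close> all phases agree and
  equality holds. For \<open>r = 0\<close> the ones are put at the factorials.
\<close>

section \<open>Binary expansions\<close>

definition bval :: "(nat \<Rightarrow> bool) \<Rightarrow> real" where
  "bval S = (\<Sum>k. of_bool (S k) * (1/2) ^ Suc k)"

lemma summable_bval: "summable (\<lambda>k. of_bool (S k) * (1/2::real) ^ Suc k)"
  by (rule summable_comparison_test'[OF sums_summable[OF power_half_series], of 0]) auto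

lemma bval_nonneg: "0 \<le> bval S"
  unfolding bval_def by (rule suminf_nonneg[OF summable_bval]) auto

lemma bval_pos: "S k \<Longrightarrow> 0 < bval S"
  unfolding bval_def by (rule suminf_pos2[OF summable_bval, of _ k]) auto

text \<open>Adding digitwise gives the geometric series. Upper bounds on \<open>bval\<close> thus
  reduce to lower bounds for the complementary sequence.\<close>

lemma bval_compl: "bval S + bval (\<lambda>k. \<not> S k) = 1"
proof -
  have "bval S + bval (\<lambda>k. \<not> S k) =
      (\<Sum>k. of_bool (S k) * (1/2) ^ Suc k + of_bool (\<not> S k) * (1/2) ^ Suc k)"
    unfolding bval_def by (rule suminf_add[OF summable_bval summable_bval])
  also have "\<dots> = (\<Sum>k. (1/2) ^ Suc k)"
    by (rule suminf_cong) auto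
  also have "\<dots> = 1"
    by (rule sums_unique[symmetric, OF power_half_series])
  finally show ?thesis .
qed

lemma bval_le_1: "bval S \<le> 1"
  using bval_compl[of S] bval_nonneg[of "\<lambda>k. \<not> S k"] by linarith

lemma bval_less_1: "\<not> S k \<Longrightarrow> bval S < 1"
  using bval_compl[of S] bval_pos[of "\<lambda>k. \<not> S k" k] by linarith

lemma bval_step: "2 * bval S = of_bool (S 0) + bval (\<lambda>j. S (Suc j))"
proof -
  have "bval S = (\<Sum>k. of_bool (S (Suc k)) * (1/2) ^ Suc (Suc k)) + of_bool (S 0) * (1/2)"
    unfolding bval_def using suminf_split_head[OF summable_bval[of S]] by simp
  also have "(\<Sum>k. of_bool (S (Suc k)) * (1/2::real) ^ Suc (Suc k)) =
      (\<Sum>k. (1/2) * (of_bool (S (Suc k)) * (1/2) ^ Suc k))"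
    by (rule suminf_cong) auto
  also have "\<dots> = (1/2) * bval (\<lambda>j. S (Suc j))"
    unfolding bval_def by (rule suminf_mult[OF summable_bval])
  finally show ?thesis by simp
qed

fun digit_prefix :: "(nat \<Rightarrow> bool) \<Rightarrow> nat \<Rightarrow> int" where
  "digit_prefix S 0 = 0"
| "digit_prefix S (Suc k) = 2 * digit_prefix S k + of_bool (S k)"

text \<open>The working form of the expansion: up to a tail in [0,1], multiplication by
  \<open>2 ^ k\<close> produces the integer spelled by the first \<open>k\<close> digits.\<close>

lemma bval_shift: "2 ^ k * bval S = of_int (digit_prefix S k) + bval (\<lambda>j. S (k + j))"
proof (induction k)
  case (Suc k)
  have "2 ^ Suc k * bval S = 2 * of_int (digit_prefix S k) + 2 * bval (\<lambda>j. S (k + j))"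
    using Suc by simp
  then show ?case
    using bval_step[of "\<lambda>j. S (k + j)"] by simp
qed simp

lemma digit_prefix_cong: "(\<And>j. j < k \<Longrightarrow> S j = S' j) \<Longrightarrow> digit_prefix S k = digit_prefix S' k"
  by (induction k) auto

lemma bval_agree:
  assumes "\<And>j. j < k \<Longrightarrow> S j = S' j"
  shows "\<bar>bval S - bval S'\<bar> \<le> 1 / 2 ^ k"
proof -
  have "2 ^ k * (bval S - bval S') = bval (\<lambda>j. S (k + j)) - bval (\<lambda>j. S' (k + j))"
    using bval_shift[of k S] bval_shift[of k S'] digit_prefix_cong[of k S S'] assms
    by (simp add: right_diff_distrib)
  then have "\<bar>2 ^ k * (bval S - bval S')\<bar> \<le> 1"
    using bval_nonneg[of "\<lambda>j. S (k + j)"] bval_nonneg[of "\<lambda>j. S' (k + j)"]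
      bval_le_1[of "\<lambda>j. S (k + j)"] bval_le_1[of "\<lambda>j. S' (k + j)"] by linarith
  then show ?thesis
    by (simp add: abs_mult pos_le_divide_eq mult.commute)
qed

text \<open>A zero beyond position \<open>k\<close> keeps the tail strictly below 1, so the floor is
  the prefix and its parity is the last digit read. Infinitely many zeros exclude precisely the
  expansions that end in ones.\<close>

lemma binary_digits_bval:
  assumes "\<exists>\<^sub>\<infinity>k. \<not> S k"
  shows "binary_digits (bval S) = S"
proof
  fix k
  obtain j where "j > k" "\<not> S j"
    using assms by (auto simp: INFM_nat)
  then have "\<not> S (Suc k + (j - Suc k))" by simp
  then have "bval (\<lambda>j. S (Suc k + j)) < 1"
    by (rule bval_less_1)
  then have "\<lfloor>2 ^ (k + 1) * bval S\<rfloor> = digit_prefix S (Suc k)"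
    using bval_shift[of "Suc k" S] bval_nonneg[of "\<lambda>j. S (Suc k + j)"]
    by (intro floor_unique) simp_all
  then show "binary_digits (bval S) k = S k"
    by (simp add: binary_digits_def)
qed

text \<open>If the value were p/q, then q times any tail would be an integer. A tail that starts
  with q zeros is at most \<open>1 / 2 ^ q\<close>, and a later one makes it positive; since q <
  2^q, that integer would lie strictly between 0 and 1.\<close>

lemma bval_irrational:
  assumes ones: "\<exists>\<^sub>\<infinity>k. S k"
    and runs: "\<And>l. \<exists>k. \<forall>j<l. \<not> S (k + j)"
  shows "bval S \<notin> \<rat>"
proof
  assume "bval S \<in> \<rat>"
  then obtain p q :: int where q: "q > 0" and pq: "bval S = of_int p / of_int q"
    by (metis Rats_cases')
  define l where "l = nat q"
  obtain k where k: "\<And>j. j < l \<Longrightarrow> \<not> S (k + j)"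
    using runs[of l] by blast
  let ?t = "bval (\<lambda>j. S (k + j))"
  have "\<bar>?t - bval (\<lambda>_. False)\<bar> \<le> 1 / 2 ^ l"
    by (rule bval_agree) (use k in auto)
  then have t_le: "?t \<le> 1 / 2 ^ l" by (simp add: bval_def)
  obtain j where "j \<ge> k" "S j"
    using ones by (auto simp: INFM_nat_le)
  then have "S (k + (j - k))" by simp
  then have t_pos: "?t > 0" by (rule bval_pos)
  have "of_int (2 ^ k * p - q * digit_prefix S k) = of_int q * ?t"
    using bval_shift[of k S] q by (simp add: pq field_simps)
  moreover have "0 < of_int q * ?t" using q t_pos by simp
  moreover have "of_int q * ?t < 1"
  proof -
    have "real_of_int q = real l" using q by (simp add: l_def)
    also have "\<dots> < 2 ^ l" by (rule of_nat_less_two_power)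
    finally have "of_int q * (1 / 2 ^ l) < (1::real)" by simp
    moreover have "of_int q * ?t \<le> of_int q * (1 / 2 ^ l)"
      using t_le q by (intro mult_left_mono) auto
    ultimately show ?thesis by linarith
  qed
  ultimately have "0 < real_of_int (2 ^ k * p - q * digit_prefix S k)"
    "real_of_int (2 ^ k * p - q * digit_prefix S k) < 1" by simp_all
  then show False by (simp only: of_int_0_less_iff of_int_less_1_iff)
qed

text \<open>Shifting by one period reproduces the sequence, so \<open>bval_shift\<close> becomes a
  linear equation for the value.\<close>

lemma bval_periodic:
  assumes "\<And>k. P (k + T) = P k"
  shows "(2 ^ T - 1) * bval P \<in> \<int>"
proof -
  have "(\<lambda>j. P (T + j)) = P" using assms by (auto simp: add.commute)
  then have "(2 ^ T - 1) * bval P = of_int (digit_prefix P T)"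
    using bval_shift[of T P] by (simp add: algebra_simps)
  then show ?thesis by simp
qed

text \<open>The approximants keep the first \<open>A\<close> digits and continue with
  \<open>P\<close>. Their denominator \<open>2 ^ A * (2 ^ T - 1)\<close> is below
  \<open>2 ^ (A + T)\<close>, while agreement up to \<open>E\<close> bounds the error by
  \<open>1 / 2 ^ E\<close>. Irrationality keeps the error nonzero.\<close>

lemma liouville_number_bval:
  assumes ones: "\<exists>\<^sub>\<infinity>k. S k"
    and irr: "bval S \<notin> \<rat>"
    and per: "\<And>n. \<exists>A T E P. n \<le> A \<and> 0 < T \<and> n * (A + T) \<le> E \<and>
        (\<forall>k. P (k + T) = P k) \<and> (\<forall>k. A \<le> k \<and> k < E \<longrightarrow> S k = P k)"
  shows "liouville_number (bval S)"
  unfolding liouville_number_def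
proof (intro allI impI)
  fix n :: nat
  assume "n > 0"
  obtain k0 where k0: "S k0"
    using ones by (auto simp: INFM_nat)
  \<comment> \<open>Raising \<open>n\<close> by \<open>Suc k0\<close> puts the digit one at
    \<open>k0\<close> inside the preserved prefix, so the approximant and its numerator are
    positive; it also gives \<open>A > 0\<close>, hence \<open>q > 1\<close>.\<close>
  obtain A T E P where A: "n + Suc k0 \<le> A" and T: "0 < T" and E: "(n + Suc k0) * (A + T) \<le> E"
    and P: "\<And>k. P (k + T) = P k" and SP: "\<And>k. A \<le> k \<Longrightarrow> k < E \<Longrightarrow> S k = P k"
    using per[of "n + Suc k0"] by blast
  define R where "R = (\<lambda>k. if k < A then S k else P k)"
  define q :: int where "q = 2 ^ A * (2 ^ T - 1)"
  have "(2::int) ^ 1 \<le> 2 ^ T" "(2::int) ^ 1 \<le> 2 ^ A"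
    using T A by (intro power_increasing; simp)+
  then have T1: "(2::int) ^ T - 1 \<ge> 1" and A1: "(2::int) ^ A \<ge> 2"
    by simp_all
  have q1: "q > 1"
    using mult_mono[OF A1 T1] by (simp add: q_def)
  have q_less: "q < 2 ^ (A + T)"
    by (simp add: q_def power_add algebra_simps)
  have "(\<lambda>j. R (A + j)) = (\<lambda>j. P (A + j))"
    by (auto simp: R_def)
  then have "of_int q * bval R =
      of_int ((2 ^ T - 1) * digit_prefix R A) + (2 ^ T - 1) * bval (\<lambda>j. P (A + j))"
    using arg_cong[OF bval_shift[of A R], of "\<lambda>x. (2 ^ T - 1) * x"]
    by (simp add: q_def distrib_left mult.assoc mult.left_commute)
  also have "\<dots> \<in> \<int>"
    using bval_periodic[of "\<lambda>j. P (A + j)" T] P[of "A + _"]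
    by (intro Ints_add) (auto simp: add.assoc)
  finally obtain p where "of_int q * bval R = of_int p"
    by (metis Ints_cases)
  then have R_eq: "bval R = of_int p / of_int q"
    using q1 by (simp add: field_simps)
  have "R k0" using k0 A by (simp add: R_def)
  then have "bval R > 0" by (rule bval_pos)
  then have p0: "p > 0" using q1 by (simp add: R_eq zero_less_divide_iff)
  have "bval R \<in> \<rat>" by (simp add: R_eq)
  then have "0 < \<bar>bval S - bval R\<bar>" using irr by auto
  moreover have "\<bar>bval S - bval R\<bar> < 1 / of_int q ^ n"
  proof -
    have "\<bar>bval S - bval R\<bar> \<le> 1 / 2 ^ E"
      by (rule bval_agree) (auto simp: R_def SP)
    also have "\<dots> \<le> 1 / 2 ^ (n * (A + T))"
    proof -
      have "n * (A + T) \<le> (n + Suc k0) * (A + T)" by (intro mult_right_mono) auto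
      then have "n * (A + T) \<le> E" using E by linarith
      then show ?thesis by (simp add: field_simps)
    qed
    also have "\<dots> < 1 / of_int q ^ n"
    proof -
      have "real_of_int q < of_int (2 ^ (A + T))"
        using q_less by (simp only: of_int_less_iff)
      then have "real_of_int q ^ n < (2 ^ (A + T)) ^ n"
        using q1 \<open>n > 0\<close> by (intro power_strict_mono) auto
      also have "\<dots> = 2 ^ (n * (A + T))" by (simp add: power_mult[symmetric] mult.commute)
      finally show ?thesis using q1 by (intro divide_strict_left_mono) auto
    qed
    finally show ?thesis .
  qed
  ultimately show "\<exists>p q :: int. p > 0 \<and> q > 1 \<and> 0 < \<bar>bval S - of_int p / of_int q\<bar> \<and>
      \<bar>bval S - of_int p / of_int q\<bar> < 1 / of_int q ^ n"
    using p0 q1 by (auto simp: R_eq)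
qed

section \<open>Block entropies\<close>

text \<open>Independence of the bits of a uniformly chosen number below \<open>2 ^ M\<close>, in
  unnormalised form. The induction splits off bit 0 by parity.\<close>

lemma sum_bits_prod:
  "(\<Sum>x::nat<2 ^ M. \<Prod>l<M. g l (bit x l)) = (\<Prod>l<M. g l False + g l True :: real)"
proof (induction M arbitrary: g)
  case (Suc M)
  have "(\<Sum>x::nat<2 ^ Suc M. \<Prod>l<Suc M. g l (bit x l)) =
      (\<Sum>x::nat<2 * 2 ^ M. if even x then g 0 False * (\<Prod>l<M. g (Suc l) (bit (x div 2) l))
        else g 0 True * (\<Prod>l<M. g (Suc l) (bit (x div 2) l)))"
    unfolding prod.lessThan_Suc_shift by (intro sum.cong) (auto simp: bit_Suc bit_0)
  also have "\<dots> = g 0 False * (\<Sum>x<2 ^ M. \<Prod>l<M. g (Suc l) (bit (x::nat) l)) +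
      g 0 True * (\<Sum>x<2 ^ M. \<Prod>l<M. g (Suc l) (bit (x::nat) l))"
    by (subst sum_split_even_odd) (simp add: sum_distrib_left)
  also have "\<dots> = (\<Prod>l<Suc M. g l False + g l True)"
    unfolding prod.lessThan_Suc_shift
    by (simp add: Suc.IH[of "\<lambda>l. g (Suc l)"] distrib_right)
  finally show ?case .
qed simp

lemma binary_words_0: "binary_words 0 = {[]}"
  by (auto simp: binary_words_def)

lemma binary_words_Suc: "binary_words (Suc m) = Cons False ` binary_words m \<union> Cons True ` binary_words m"
  by (auto simp: binary_words_def length_Suc_conv image_iff)

lemma finite_binary_words [simp]: "finite (binary_words m)"
  by (induction m) (simp_all add: binary_words_0 binary_words_Suc)

lemma sum_binary_words_prod:
  "(\<Sum>v\<in>binary_words m. \<Prod>l<m. g l (v ! l)) = (\<Prod>l<m. g l False + g l True :: real)"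
proof (induction m arbitrary: g)
  case (Suc m)
  have "(\<Sum>v\<in>binary_words (Suc m). \<Prod>l<Suc m. g l (v ! l)) =
      (\<Sum>v\<in>binary_words m. \<Prod>l<Suc m. g l ((False # v) ! l)) +
      (\<Sum>v\<in>binary_words m. \<Prod>l<Suc m. g l ((True # v) ! l))"
    unfolding binary_words_Suc
    by (subst sum.union_disjoint) (auto simp: sum.reindex inj_on_def)
  also have "\<dots> = (\<Prod>l<Suc m. g l False + g l True)"
    unfolding prod.lessThan_Suc_shift
    by (simp add: sum_distrib_left[symmetric] Suc.IH[of "\<lambda>l. g (Suc l)"] distrib_right)
  finally show ?case .
qed (simp add: binary_words_0)

text \<open>The delicate point is 0, where continuity holds only from the right; hence the demand
  that \<open>f\<close> be eventually nonnegative.\<close>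

lemma tendsto_entropy_term:
  assumes "(f \<longlongrightarrow> p) F" and "eventually (\<lambda>x. f x \<ge> 0) F" and "p \<ge> (0::real)"
  shows "((\<lambda>x. f x * log 2 (1 / f x)) \<longlongrightarrow> p * log 2 (1 / p)) F"
proof -
  have "continuous_on {0..} (\<lambda>x::real. x * log 2 (1 / x))"
    unfolding continuous_on_def
  proof
    fix x :: real
    assume "x \<in> {0..}"
    then consider "x = 0" | "x > 0" by fastforce
    then show "((\<lambda>x. x * log 2 (1 / x)) \<longlongrightarrow> x * log 2 (1 / x)) (at x within {0..})"
    proof cases
      case 1
      have "((\<lambda>x::real. x * log 2 (1 / x)) \<longlongrightarrow> 0) (at_right 0)"
        by real_asymp
      then show ?thesis using 1 by (simp add: at_within_Ici_at_right)
    next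
      case 2
      then have "isCont (\<lambda>x. x * log 2 (1 / x)) x"
        by (intro continuous_intros) auto
      then show ?thesis
        unfolding isCont_def by (rule tendsto_within_subset) simp
    qed
  qed
  from continuous_on_tendsto_compose[OF this assms(1)] assms(2,3) show ?thesis by simp
qed

section \<open>Lower block entropies from limiting frequencies\<close>

lemma block_frequency_nonneg: "0 \<le> block_frequency m S n w"
  by (simp add: block_frequency_def)

lemma lower_block_entropy_limit:
  assumes "\<And>v. v \<in> binary_words m \<Longrightarrow> (\<lambda>n. block_frequency m S n v) \<longlonglongrightarrow> \<pi> v"
  shows "lower_block_entropy m S = ereal (shannon_entropy (binary_words m) \<pi> / real m)"
proof -
  have "0 \<le> \<pi> v" if "v \<in> binary_words m" for v
    using assms[OF that] by (rule LIMSEQ_le_const) (simp add: block_frequency_nonneg)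
  then have "(\<lambda>n. shannon_entropy (binary_words m) (block_frequency m S n))
      \<longlonglongrightarrow> shannon_entropy (binary_words m) \<pi>"
    unfolding shannon_entropy_def using assms
    by (intro tendsto_sum tendsto_entropy_term) (auto simp: block_frequency_nonneg)
  then have "liminf (\<lambda>n. ereal (shannon_entropy (binary_words m) (block_frequency m S n))) =
      ereal (shannon_entropy (binary_words m) \<pi>)"
    by (intro lim_imp_Liminf) auto
  then show ?thesis
    by (simp add: lower_block_entropy_def)
qed

lemma lower_block_entropy_nonneg: "0 \<le> lower_block_entropy m S"
proof -
  have "0 \<le> shannon_entropy (binary_words m) (block_frequency m S n)" for n
    unfolding shannon_entropy_def
  proof (rule sum_nonneg)
    fix w
    let ?f = "block_frequency m S n w"
    have "card {t. t < n \<and> map S [t * m..<(t + 1) * m] = w} \<le> card {..<n}"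
      by (intro card_mono) auto
    then have "?f \<le> 1"
      by (cases "n = 0") (auto simp: block_frequency_def field_simps)
    then show "0 \<le> ?f * log 2 (1 / ?f)"
      using block_frequency_nonneg[of m S n w] by (cases "?f = 0") auto
  qed
  then have "0 \<le> liminf (\<lambda>n. ereal (shannon_entropy (binary_words m) (block_frequency m S n)))"
    by (intro Liminf_bounded) simp
  then show ?thesis
    by (simp add: lower_block_entropy_def)
qed

section \<open>Averages of stagewise periodic sequences\<close>

lemma sum_periodic_cancel:
  fixes d :: "nat \<Rightarrow> real"
  assumes per: "\<And>t. d (t + \<tau>) = d t" and zero: "(\<Sum>t<\<tau>. d t) = 0"
  shows "(\<Sum>t<n. d t) = (\<Sum>t<n mod \<tau>. d t)"
proof -
  have 1: "(\<Sum>t<\<tau> + n. d t) = (\<Sum>t<n. d t)" for n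
    by (induction n) (simp_all add: zero add.commute[of \<tau>] per)
  have "(\<Sum>t<q * \<tau> + n. d t) = (\<Sum>t<n. d t)" for q n
    by (induction q) (simp_all add: 1 add.assoc)
  from this[of "n div \<tau>" "n mod \<tau>"] show ?thesis by simp
qed

text \<open>Stage boundaries are multiples of the period, so a complete stage contributes no
  deviation from \<open>p\<close>. Inside stage \<open>i\<close> only an incomplete period counts,
  of size at most \<open>\<tau> i\<close>, and \<open>i * \<tau> i \<le> l i\<close> makes this
  negligible against \<open>n\<close>.\<close>

lemma staged_average_tendsto:
  fixes g :: "nat \<Rightarrow> real" and c :: "nat \<Rightarrow> nat \<Rightarrow> real" and l \<tau> :: "nat \<Rightarrow> nat"
  assumes mono: "\<And>i. i \<ge> i0 \<Longrightarrow> l i < l (Suc i)"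
    and agree: "\<And>i t. i \<ge> i0 \<Longrightarrow> l i \<le> t \<Longrightarrow> t < l (Suc i) \<Longrightarrow> g t = c i t"
    and per: "\<And>i t. i \<ge> i0 \<Longrightarrow> c i (t + \<tau> i) = c i t"
    and avg: "\<And>i. i \<ge> i0 \<Longrightarrow> (\<Sum>t<\<tau> i. c i t) = real (\<tau> i) * p"
    and start: "\<And>i. i \<ge> i0 \<Longrightarrow> \<tau> i dvd l i"
    and stop: "\<And>i. i \<ge> i0 \<Longrightarrow> \<tau> i dvd l (Suc i)"
    and pos: "\<And>i. i \<ge> i0 \<Longrightarrow> \<tau> i > 0"
    and small: "\<And>i. i \<ge> i0 \<Longrightarrow> i * \<tau> i \<le> l i"
    and bnd: "\<And>i t. i \<ge> i0 \<Longrightarrow> \<bar>c i t - p\<bar> \<le> 1"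
  shows "(\<lambda>n. (\<Sum>t<n. g t) / real n) \<longlonglongrightarrow> p"
proof -
  define D where "D = (\<lambda>n. \<Sum>t<n. g t - p)"
  \<comment> \<open>Since \<open>l i\<close> is a multiple of the period, the deviation of
    \<open>c i\<close> over \<open>{l i..<n}\<close> equals that over \<open>{..<n}\<close>, where
    all full periods cancel.\<close>
  have D_eq: "D n = D (l i) + (\<Sum>t<n mod \<tau> i. c i t - p)"
    if i: "i \<ge> i0" and n: "l i \<le> n" "n \<le> l (Suc i)" for i n
  proof -
    let ?d = "\<lambda>t. c i t - p"
    have cancel: "(\<Sum>t<n. ?d t) = (\<Sum>t<n mod \<tau> i. ?d t)" for n
      by (rule sum_periodic_cancel) (use i in \<open>simp_all add: per avg sum_subtractf\<close>)
    have split: "(\<Sum>t<n. f t) = (\<Sum>t<l i. f t) + (\<Sum>t=l i..<n. f t)" for f :: "nat \<Rightarrow> real"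
      using sum.atLeastLessThan_concat[of 0 "l i" n f] n by (simp add: atLeast0LessThan)
    have "(\<Sum>t<l i. ?d t) = 0"
      using cancel[of "l i"] start[OF i] by simp
    moreover have "(\<Sum>t=l i..<n. g t - p) = (\<Sum>t=l i..<n. ?d t)"
      using n by (intro sum.cong) (auto simp: agree[OF i])
    ultimately show ?thesis
      using split[of "\<lambda>t. g t - p"] split[of ?d] cancel[of n] by (simp add: D_def)
  qed
  have D_start: "D (l i) = D (l i0)" if "i \<ge> i0" for i
    using that
  proof (induction i rule: dec_induct)
    case (step i)
    then show ?case
      using D_eq[of i "l (Suc i)"] mono[of i] stop[of i] by simp
  qed simp
  have D_le: "\<bar>D n\<bar> \<le> \<bar>D (l i0)\<bar> + \<tau> i"
    if i: "i \<ge> i0" and n: "l i \<le> n" "n < l (Suc i)" for i n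
  proof -
    have "\<bar>\<Sum>t<n mod \<tau> i. c i t - p\<bar> \<le> (\<Sum>t<n mod \<tau> i. \<bar>c i t - p\<bar>)"
      by (rule sum_abs)
    also have "\<dots> \<le> (\<Sum>t<n mod \<tau> i. 1)"
      using bnd[OF i] by (intro sum_mono) auto
    also have "\<dots> \<le> \<tau> i"
      using mod_less_divisor[OF pos[OF i], of n] by simp
    finally show ?thesis
      using D_eq[OF i, of n] D_start[OF i] n by simp
  qed
  have stage: "\<exists>i\<ge>N. l i \<le> n \<and> n < l (Suc i)" if "N \<ge> i0" "l N \<le> n" for N n
    using that(2)
  proof (induction n rule: dec_induct)
    case base
    then show ?case using mono[OF that(1)] by auto
  next
    case (step n)
    then obtain i where i: "i \<ge> N" "l i \<le> n" "n < l (Suc i)" by blast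
    show ?case
    proof (cases "Suc n < l (Suc i)")
      case True
      then show ?thesis using i by (intro exI[of _ i]) auto
    next
      case False
      then have "Suc n = l (Suc i)" using i by simp
      then show ?thesis
        using i that(1) mono[of "Suc i"] by (intro exI[of _ "Suc i"]) auto
    qed
  qed
  have "(\<lambda>n. D n / real n) \<longlonglongrightarrow> 0"
  proof (rule LIMSEQ_I)
    fix e :: real
    assume e: "e > 0"
    \<comment> \<open>\<open>N0\<close> and \<open>N1\<close> keep the incomplete period and the
      fixed initial deviation each at most half of \<open>e * n\<close>.\<close>
    obtain N0 where N0: "real N0 > 2 / e" using reals_Archimedean2 by blast
    obtain N1 where N1: "real N1 > 2 * \<bar>D (l i0)\<bar> / e" using reals_Archimedean2 by blast
    define N where "N = max i0 N0 + 1"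
    have "norm (D n / real n - 0) < e" if n: "n \<ge> max (l N) (Suc N1)" for n
    proof -
      obtain i where i: "i \<ge> N" "l i \<le> n" "n < l (Suc i)"
        using stage[of N n] n by (force simp: N_def)
      then have i0: "i \<ge> i0" by (simp add: N_def)
      have "2 / e < real i" using N0 i(1) by (simp add: N_def)
      then have "2 / e * real (\<tau> i) \<le> real i * real (\<tau> i)"
        by (intro mult_right_mono) auto
      also have "\<dots> \<le> n"
        using small[OF i0] i(2) by (simp flip: of_nat_mult)
      finally have 1: "2 * real (\<tau> i) \<le> e * n"
        using e by (simp add: field_simps)
      have "2 * \<bar>D (l i0)\<bar> / e < n" using N1 n by simp
      then have 2: "2 * \<bar>D (l i0)\<bar> < e * n"
        using e by (simp add: field_simps)
      have "\<bar>D n\<bar> < e * n"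
        using D_le[OF i0 i(2,3)] 1 2 by linarith
      then show ?thesis
        using n by (simp add: field_simps)
    qed
    then show "\<exists>no. \<forall>n\<ge>no. norm (D n / real n - 0) < e" by blast
  qed
  then have "(\<lambda>n. D n / real n + p) \<longlonglongrightarrow> 0 + p"
    by (intro tendsto_intros)
  moreover have "\<forall>\<^sub>F n in sequentially. D n / real n + p = (\<Sum>t<n. g t) / real n"
    using eventually_gt_at_top[of 0]
    by eventually_elim (simp add: D_def sum_subtractf field_simps)
  ultimately show ?thesis
    by (simp add: tendsto_cong)
qed

section \<open>Distributions of masked blocks\<close>

text \<open>Concavity of entropy by Gibbs' inequality: the entropy of each \<open>P j\<close> is at
  most its cross entropy against the mixture, and these cross entropies average to the entropy of
  the mixture.\<close>

lemma entropy_mixture_ge: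
  fixes P :: "nat \<Rightarrow> 'a \<Rightarrow> real"
  assumes nonneg: "\<And>j v. 0 \<le> P j v"
    and total: "\<And>j. (\<Sum>v\<in>\<Omega>. P j v) = 1"
    and b: "b > 0"
  shows "(\<Sum>j<b. shannon_entropy \<Omega> (P j)) / b \<le> shannon_entropy \<Omega> (\<lambda>v. (\<Sum>j<b. P j v) / b)"
proof -
  define p where "p v = (\<Sum>j<b. P j v) / b" for v
  have p_nonneg: "0 \<le> p v" for v
    by (simp add: p_def sum_nonneg nonneg)
  have p_sum: "(\<Sum>v\<in>\<Omega>. p v) = 1"
    unfolding p_def sum_divide_distrib[symmetric]
    by (subst sum.swap) (use b in \<open>simp add: total\<close>)
  \<comment> \<open>The correction \<open>(P j v - p v) / ln 2\<close> comes from ln x \<le> x - 1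
    at x = p/P. It makes the inequality hold termwise and sums to 0, both masses being 1.\<close>
  have term_ge: "P j v * log 2 (1 / P j v) + (P j v - p v) / ln 2 \<le> P j v * log 2 (1 / p v)"
    if "j < b" for j v
  proof (cases "P j v = 0")
    case True
    then show ?thesis using p_nonneg[of v] by simp
  next
    case False
    then have P: "P j v > 0" using nonneg[of j v] by simp
    have "P j v \<le> (\<Sum>j<b. P j v)"
      using that by (intro member_le_sum) (auto simp: nonneg)
    then have p: "p v > 0" using P b by (simp add: p_def)
    have "ln (p v / P j v) \<le> p v / P j v - 1"
      using P p by (intro ln_le_minus_one) auto
    then have "P j v * ln (p v / P j v) \<le> P j v * (p v / P j v - 1)"
      using P by (intro mult_left_mono) auto
    also have "\<dots> = p v - P j v" using P by (simp add: field_simps)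
    finally have "P j v * (ln (p v) - ln (P j v)) \<le> p v - P j v"
      using P p by (simp add: ln_div)
    then have "P j v * (ln (p v) - ln (P j v)) / ln 2 \<le> (p v - P j v) / ln 2"
      by (intro divide_right_mono) auto
    then show ?thesis
      using P p by (simp add: log_def ln_div right_diff_distrib diff_divide_distrib)
  qed
  have "shannon_entropy \<Omega> (P j) \<le> (\<Sum>v\<in>\<Omega>. P j v * log 2 (1 / p v))" if "j < b" for j
  proof -
    have "shannon_entropy \<Omega> (P j) =
        (\<Sum>v\<in>\<Omega>. P j v * log 2 (1 / P j v) + (P j v - p v) / ln 2)"
      by (simp add: shannon_entropy_def sum.distrib sum_subtractf total p_sum
          flip: sum_divide_distrib)
    also have "\<dots> \<le> (\<Sum>v\<in>\<Omega>. P j v * log 2 (1 / p v))"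
      by (intro sum_mono term_ge that)
    finally show ?thesis .
  qed
  then have "(\<Sum>j<b. shannon_entropy \<Omega> (P j)) \<le> (\<Sum>j<b. \<Sum>v\<in>\<Omega>. P j v * log 2 (1 / p v))"
    by (intro sum_mono) simp
  also have "\<dots> = b * shannon_entropy \<Omega> p"
  proof -
    have "(\<Sum>j<b. P j v) = b * p v" for v using b by (simp add: p_def)
    then show ?thesis
      by (subst sum.swap)
        (simp add: shannon_entropy_def sum_distrib_left mult.assoc flip: sum_distrib_right)
  qed
  finally have "(\<Sum>j<b. shannon_entropy \<Omega> (P j)) / b \<le> shannon_entropy \<Omega> p"
    using b by (simp add: field_simps)
  then show ?thesis by (simp add: p_def[abs_def])
qed

lemma sum_lessThan_mult: "(\<Sum>t<n * k. f t) = (\<Sum>x<n. \<Sum>s<k. f (x * k + s))"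
  for f :: "nat \<Rightarrow> 'a :: comm_monoid_add"
proof -
  have "(\<Sum>s<k. f (x * k + s)) = sum f {x * k..<x * k + k}" for x
    using sum.shift_bounds_nat_ivl[of f 0 "x * k" k] by (simp add: atLeast0LessThan add.commute)
  then show ?thesis by (simp add: sum.nat_group)
qed

text \<open>Lets a condition on \<open>m\<close> consecutive bits be written as a product over all
  \<open>M\<close> bits, as \<open>sum_bits_prod\<close> requires.\<close>

lemma prod_lessThan_window:
  fixes f :: "nat \<Rightarrow> real"
  assumes "s + m \<le> M"
  shows "(\<Prod>j<M. if s \<le> j \<and> j < s + m then f (j - s) else 1) = (\<Prod>l<m. f l)"
proof -
  have "(\<Prod>j<M. if s \<le> j \<and> j < s + m then f (j - s) else 1) =
      (\<Prod>j<M. if j \<in> {s..<s + m} then f (j - s) else 1)"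
    by simp
  also have "\<dots> = (\<Prod>j\<in>{..<M} \<inter> {s..<s + m}. f (j - s))"
    by (rule prod.inter_restrict[symmetric]) simp
  also have "{..<M} \<inter> {s..<s + m} = {s..<s + m}" using assms by auto
  also have "(\<Prod>j\<in>{s..<s + m}. f (j - s)) = (\<Prod>l<m. f l)"
    using prod.shift_bounds_nat_ivl[of "\<lambda>j. f (j - s)" 0 s m]
    by (simp add: atLeast0LessThan add.commute)
  finally show ?thesis .
qed

lemma prod_of_bool_lessThan: "(\<Prod>l<(m::nat). of_bool (P l) :: real) = of_bool (\<forall>l<m. P l)"
  by (induction m) (auto simp: less_Suc_eq)

text \<open>
  The probability of the word \<open>v\<close> as the \<open>s\<close>-th block of length \<open>m\<close> when the positions in
  \<open>F\<close> carry independent fair bits and all others carry 0.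
\<close>

definition block_weight :: "(nat \<Rightarrow> bool) \<Rightarrow> nat \<Rightarrow> nat \<Rightarrow> bool list \<Rightarrow> real" where
  "block_weight F m s v = (\<Prod>l<m. if F (s * m + l) then 1 / 2 else of_bool (\<not> v ! l))"

lemma block_weight_nonneg: "0 \<le> block_weight F m s v"
  unfolding block_weight_def by (rule prod_nonneg) auto

lemma sum_block_weight: "(\<Sum>v\<in>binary_words m. block_weight F m s v) = 1"
  unfolding block_weight_def
  by (subst sum_binary_words_prod[where g = "\<lambda>l e. if F (s * m + l) then 1 / 2 else of_bool (\<not> e)"])
    (rule prod.neutral, auto)

text \<open>This exhibits the distribution as uniform on the words that vanish off
  \<open>F\<close>.\<close>

lemma block_weight_eq:
  "block_weight F m s v =
     (1 / 2) ^ card {l. l < m \<and> F (s * m + l)} * of_bool (\<forall>l<m. F (s * m + l) \<or> \<not> v ! l)"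
proof -
  have "block_weight F m s v =
      (\<Prod>l<m. (if l \<in> {l. F (s * m + l)} then 1 / 2 else 1) * of_bool (F (s * m + l) \<or> \<not> v ! l))"
    unfolding block_weight_def by (rule prod.cong) auto
  also have "\<dots> = (\<Prod>l\<in>{..<m} \<inter> {l. F (s * m + l)}. 1 / 2) *
      of_bool (\<forall>l<m. F (s * m + l) \<or> \<not> v ! l)"
    unfolding prod.distrib prod_of_bool_lessThan by (subst prod.inter_restrict[symmetric]) auto
  also have "{..<m} \<inter> {l. F (s * m + l)} = {l. l < m \<and> F (s * m + l)}" by auto
  finally show ?thesis by (simp only: prod_constant)
qed

text \<open>A uniform distribution on \<open>2 ^ d\<close> words has entropy \<open>d\<close>, and
  \<open>d\<close> is the number of free positions in the block.\<close>

lemma entropy_block_weight: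
  "shannon_entropy (binary_words m) (block_weight F m s) = card {l. l < m \<and> F (s * m + l)}"
proof -
  have "block_weight F m s v * log 2 (1 / block_weight F m s v) =
      block_weight F m s v * card {l. l < m \<and> F (s * m + l)}" for v
    by (auto simp: block_weight_eq power_one_over log_nat_power)
  then show ?thesis
    by (simp only: shannon_entropy_def sum_distrib_right[symmetric] sum_block_weight mult_1)
qed

text \<open>Among all words of length \<open>M\<close>, masked by \<open>F\<close>, the
  \<open>s\<close>-th block has exactly the distribution \<open>block_weight\<close>: the indicator
  is a product over bits, so the sum factorises.\<close>

lemma sum_bits_window:
  assumes "s * m + m \<le> M" "length v = m"
  shows "(\<Sum>x::nat<2 ^ M. of_bool (\<forall>l<m. v ! l = (F (s * m + l) \<and> bit x (s * m + l)))) =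
    2 ^ M * block_weight F m s v"
proof -
  define g where "g j e = (if s * m \<le> j \<and> j < s * m + m
    then of_bool (v ! (j - s * m) = (F (s * m + (j - s * m)) \<and> e)) else (1::real))" for j e
  have "of_bool (\<forall>l<m. v ! l = (F (s * m + l) \<and> bit x (s * m + l))) = (\<Prod>j<M. g j (bit x j))"
    for x :: nat
  proof -
    have "(\<Prod>j<M. g j (bit x j)) = (\<Prod>j<M. if s * m \<le> j \<and> j < s * m + m
        then of_bool (v ! (j - s * m) = (F (s * m + (j - s * m)) \<and> bit x (s * m + (j - s * m)))) else 1)"
      by (rule prod.cong) (auto simp: g_def)
    also have "\<dots> = of_bool (\<forall>l<m. v ! l = (F (s * m + l) \<and> bit x (s * m + l)))"
      by (subst prod_lessThan_window[OF assms(1)]) (rule prod_of_bool_lessThan)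
    finally show ?thesis by simp
  qed
  then have "(\<Sum>x::nat<2 ^ M. of_bool (\<forall>l<m. v ! l = (F (s * m + l) \<and> bit x (s * m + l)))) =
      (\<Prod>j<M. g j False + g j True)"
    by (simp add: sum_bits_prod)
  \<comment> \<open>Each bit contributes 2 outside the window, 1 at a free position inside it, and 2
    or 0 at a masked one; a factor 2 is pulled out of every case.\<close>
  also have "\<dots> = (\<Prod>j<M. 2 * (if s * m \<le> j \<and> j < s * m + m
      then if F (s * m + (j - s * m)) then 1 / 2 else of_bool (\<not> v ! (j - s * m)) else 1))"
    by (rule prod.cong) (auto simp: g_def)
  also have "\<dots> = 2 ^ M * block_weight F m s v"
    unfolding prod.distrib block_weight_def by (subst prod_lessThan_window[OF assms(1)]) simp
  finally show ?thesis .
qed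

section \<open>Positive dimension\<close>

locale masked_stages =
  fixes a b :: nat
  assumes a_pos: "0 < a" and a_le: "a \<le> b"
begin

definition mask :: "nat \<Rightarrow> bool" where
  "mask k \<longleftrightarrow> k mod b < a"

text \<open>The factor \<open>b\<close> aligns words with the mask; the factorial makes every block
  length \<open>m \<le> i\<close> a divisor.\<close>

definition word_length :: "nat \<Rightarrow> nat" where
  "word_length i = b * fact i"

definition period :: "nat \<Rightarrow> nat" where
  "period i = word_length i * 2 ^ word_length i"

text \<open>
  Without the mask, stage \<open>i\<close> repeats the concatenation of all words of length \<open>word_length i\<close>, so
  that every block length dividing \<open>word_length i\<close> sees each word equally often in one period.
\<close>

definition stage_digit :: "nat \<Rightarrow> nat \<Rightarrow> bool" where
  "stage_digit i k \<longleftrightarrow> mask k \<and> bit (k div word_length i) (k mod word_length i)"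

text \<open>The factor \<open>period (Suc i)\<close> makes the boundary a multiple of the periods on
  both sides of it. The factor \<open>Suc i\<close> serves twice: times the sum, it gives the
  Liouville gap; times the new period, it makes that period small against the start.\<close>

fun stage_start :: "nat \<Rightarrow> nat" where
  "stage_start 0 = 0"
| "stage_start (Suc i) = Suc i * period (Suc i) * (stage_start i + period i)"

definition digits :: "nat \<Rightarrow> bool" where
  "digits k = stage_digit (LEAST i. k < stage_start (Suc i)) k"

section \<open>Arithmetic of the stages\<close>

lemma b_pos: "0 < b"
  using a_pos a_le by simp

lemma word_length_pos: "0 < word_length i"
  using b_pos by (simp add: word_length_def)

lemma period_pos: "0 < period i"
  using word_length_pos by (simp add: period_def)

lemma word_length_less_period: "word_length i < period i"
  using word_length_pos[of i] one_less_power[of "2::nat" "word_length i"] by (simp add: period_def)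

lemma period_dvd_Suc: "period i dvd period (Suc i)"
proof -
  have "word_length i dvd word_length (Suc i)"
    by (simp add: word_length_def)
  moreover from this have "word_length i \<le> word_length (Suc i)"
    using word_length_pos by (intro dvd_imp_le) auto
  ultimately show ?thesis
    unfolding period_def by (intro mult_dvd_mono le_imp_power_dvd)
qed

lemma period_dvd_start: "period i dvd stage_start i"
  by (cases i) auto

lemma period_dvd_start_Suc: "period i dvd stage_start (Suc i)"
  using period_dvd_Suc[of i] by (simp add: dvd_mult dvd_mult2)

lemma stage_start_Suc_ge: "Suc i * (stage_start i + period i) \<le> stage_start (Suc i)"
proof -
  have "Suc i * 1 * (stage_start i + period i) \<le> stage_start (Suc i)"
    unfolding stage_start.simps using period_pos[of "Suc i"]
    by (intro mult_right_mono mult_left_mono) auto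
  then show ?thesis by (simp only: mult_1_right)
qed

lemma stage_start_less: "stage_start i < stage_start (Suc i)"
  using stage_start_Suc_ge[of i] period_pos[of i] by (simp del: stage_start.simps)

lemma strict_mono_stage_start: "strict_mono stage_start"
  by (simp add: strict_mono_Suc_iff stage_start_less del: stage_start.simps)

lemma mult_period_le_start: "i * period i \<le> stage_start i"
proof (cases i)
  case (Suc j)
  have "i * period i * 1 \<le> i * period i * (stage_start j + period j)"
    using period_pos[of j] by (intro mult_left_mono) auto
  then show ?thesis by (simp add: Suc)
qed simp

lemma digits_stage:
  assumes "stage_start i \<le> k" "k < stage_start (Suc i)"
  shows "digits k = stage_digit i k"
proof -
  have "(LEAST i. k < stage_start (Suc i)) = i"
  proof (rule Least_equality)
    fix j
    assume "k < stage_start (Suc j)"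
    then have "stage_start i < stage_start (Suc j)" using assms(1) by simp
    then have "i < Suc j" using strict_mono_stage_start by (simp only: strict_mono_less)
    then show "i \<le> j" by simp
  qed (rule assms)
  then show ?thesis by (simp only: digits_def)
qed

lemma mask_add_mult: "mask (c * b + k) = mask k"
  by (simp add: mask_def)

lemma mask_add_word_length: "mask (x * word_length i + k) = mask k"
  using mask_add_mult[of "x * fact i" k] by (simp add: word_length_def mult_ac)

lemma stage_digit_word:
  assumes "k < word_length i"
  shows "stage_digit i (x * word_length i + k) \<longleftrightarrow> mask k \<and> bit x k"
  using assms by (simp add: stage_digit_def mask_add_word_length)

text \<open>Word numbers are not reduced modulo \<open>2 ^ word_length i\<close>, but only bits
  below \<open>word_length i\<close> are read, and adding that power leaves them unchanged.\<close>

lemma stage_digit_periodic: "stage_digit i (k + period i) = stage_digit i k"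
proof -
  let ?M = "word_length i"
  define x s where "x = k div ?M" and "s = k mod ?M"
  have s: "s < ?M" using word_length_pos by (simp add: s_def)
  have k: "k = x * ?M + s" by (simp only: x_def s_def div_mult_mod_eq)
  have "k + period i = (x + 2 ^ ?M) * ?M + s"
    by (simp add: k period_def algebra_simps)
  moreover have "bit (x + 2 ^ ?M) s = bit x s"
  proof -
    have "take_bit ?M (x + 2 ^ ?M) = take_bit ?M x" by (simp add: take_bit_eq_mod)
    then have "bit (take_bit ?M (x + 2 ^ ?M)) s = bit (take_bit ?M x) s" by (simp only:)
    then show ?thesis using s by (simp add: bit_take_bit_iff)
  qed
  ultimately show ?thesis
    using s by (simp only: k stage_digit_word)
qed

lemma stage_digit_periodic_mult: "stage_digit i (c * period i + k) = stage_digit i k"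
proof (induction c)
  case (Suc c)
  then show ?case
    using stage_digit_periodic[of i "c * period i + k"] by (simp add: add_ac)
qed simp

lemma digits_at_start:
  assumes "k < period i"
  shows "digits (stage_start i + k) = stage_digit i k"
proof -
  have "stage_start i + k < stage_start i + period i" using assms by simp
  also have "\<dots> \<le> stage_start (Suc i)"
    using stage_start_Suc_ge[of i] by (simp del: stage_start.simps)
  finally have "digits (stage_start i + k) = stage_digit i (stage_start i + k)"
    by (intro digits_stage) auto
  also obtain c where "stage_start i = c * period i"
    using period_dvd_start[of i] by (auto simp: dvd_def mult.commute)
  then have "stage_digit i (stage_start i + k) = stage_digit i k"
    by (simp add: stage_digit_periodic_mult)
  finally show ?thesis .
qed

section \<open>Runs of zeros, ones, and the Liouville property\<close>

lemma le_stage_start: "i \<le> stage_start i"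
  using strict_mono_stage_start by (rule strict_mono_imp_increasing)

lemma le_word_length: "i \<le> word_length i"
proof -
  have "i \<le> fact i" by (rule fact_ge_self)
  also have "\<dots> \<le> word_length i" using b_pos by (simp add: word_length_def)
  finally show ?thesis .
qed

text \<open>Stage \<open>l\<close> opens with word number 0, which is a run of
  \<open>word_length l\<close> zeros.\<close>

lemma digits_zero_run: "\<exists>k. \<forall>j<l. \<not> digits (k + j)"
proof (intro exI allI impI)
  fix j
  assume "j < l"
  then have j: "j < word_length l" using le_word_length[of l] by simp
  then show "\<not> digits (stage_start l + j)"
    using digits_at_start[of j l] stage_digit_word[OF j, of 0] word_length_less_period[of l] by simp
qed

lemma infinitely_many_zeros: "\<exists>\<^sub>\<infinity>k. \<not> digits k"
  unfolding INFM_nat_le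
proof
  fix n
  have "\<not> digits (stage_start n + 0)"
    using digits_at_start[of 0 n] stage_digit_word[of 0 n 0] word_length_pos[of n] period_pos[of n]
    by simp
  then show "\<exists>k\<ge>n. \<not> digits k"
    using le_stage_start[of n] by auto
qed

lemma infinitely_many_ones: "\<exists>\<^sub>\<infinity>k. digits k"
  unfolding INFM_nat_le
proof
  fix n
  \<comment> \<open>Word number 1 has its bit 0 set, and \<open>a > 0\<close> leaves that position
    unmasked.\<close>
  have "stage_digit n (1 * word_length n + 0)"
    using a_pos by (subst stage_digit_word) (simp_all add: word_length_pos mask_def bit_0)
  then have "digits (stage_start n + word_length n)"
    using digits_at_start[OF word_length_less_period[of n]] by simp
  then show "\<exists>k\<ge>n. digits k"
    using le_stage_start[of n] by (intro exI[of _ "stage_start n + word_length n"]) auto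
qed

lemma liouville_number_digits: "liouville_number (bval digits)"
proof (rule liouville_number_bval)
  show "bval digits \<notin> \<rat>"
    by (intro bval_irrational infinitely_many_ones digits_zero_run)
  fix n
  have "n * (stage_start n + period n) \<le> Suc n * (stage_start n + period n)" by simp
  also have "\<dots> \<le> stage_start (Suc n)" by (rule stage_start_Suc_ge)
  finally have "n * (stage_start n + period n) \<le> stage_start (Suc n)" .
  then show "\<exists>A T E P. n \<le> A \<and> 0 < T \<and> n * (A + T) \<le> E \<and>
      (\<forall>k. P (k + T) = P k) \<and> (\<forall>k. A \<le> k \<and> k < E \<longrightarrow> digits k = P k)"
    using le_stage_start[of n] period_pos[of n] digits_stage[of n] stage_digit_periodic[of n]
    by (intro exI[of _ "stage_start n"] exI[of _ "period n"] exI[of _ "stage_start (Suc n)"]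
        exI[of _ "stage_digit n"]) (simp del: stage_start.simps)
qed (rule infinitely_many_ones)

text \<open>The distribution of the \<open>t\<close>-th block depends on \<open>t\<close> modulo
  \<open>b\<close> only. Averaging over all \<open>j < b\<close> is right also when \<open>m\<close>
  and \<open>b\<close> share a factor: phases then repeat equally often.\<close>

definition limit_frequency :: "nat \<Rightarrow> bool list \<Rightarrow> real" where
  "limit_frequency m v = (\<Sum>j<b. block_weight mask m j v) / b"

lemma block_weight_mask_periodic: "block_weight mask m (c * b + j) v = block_weight mask m j v"
proof -
  have "mask ((c * b + j) * m + l) = mask (j * m + l)" for l
    using mask_add_mult[of "c * m" "j * m + l"] by (simp add: algebra_simps)
  then show ?thesis by (simp add: block_weight_def)
qed

lemma map_eq_iff_nth:
  "length v = m \<Longrightarrow> map S [t * m..<(t + 1) * m] = v \<longleftrightarrow> (\<forall>l<m. v ! l = S (t * m + l))"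
  by (auto simp: list_eq_iff_nth_eq)

text \<open>One period lists all words, each cut into \<open>c * b\<close> blocks. For a fixed block
  index \<open>s\<close>, letting the word vary gives \<open>block_weight mask m s v\<close>; then
  \<open>s\<close> runs \<open>c\<close> times through the residues modulo \<open>b\<close>.\<close>

lemma stage_block_average:
  assumes m: "0 < m" "m \<le> i" and v: "length v = m"
  shows "(\<Sum>t<period i div m. of_bool (map (stage_digit i) [t * m..<(t + 1) * m] = v)) =
    real (period i div m) * limit_frequency m v"
proof -
  let ?M = "word_length i"
  have "m dvd fact i" using m by (intro dvd_fact) auto
  then obtain c where c: "fact i = m * c" by (auto simp: dvd_def)
  have M: "?M = c * b * m" by (simp add: word_length_def c mult_ac)
  have \<tau>: "period i div m = 2 ^ ?M * (c * b)"
    using m by (simp add: period_def M mult_ac)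
  \<comment> \<open>Block number \<open>x * (c * b) + s\<close> is the \<open>s\<close>-th block of
    word \<open>x\<close>; no block straddles two words because \<open>m\<close> divides the word
    length.\<close>
  have block: "map (stage_digit i) [(x * (c * b) + s) * m..<(x * (c * b) + s + 1) * m] = v \<longleftrightarrow>
      (\<forall>l<m. v ! l = (mask (s * m + l) \<and> bit x (s * m + l)))" if s: "s < c * b" for x s
  proof -
    have "stage_digit i ((x * (c * b) + s) * m + l) = (mask (s * m + l) \<and> bit x (s * m + l))"
      if "l < m" for l
    proof -
      have "s * m + l < Suc s * m" using that by simp
      also have "\<dots> \<le> ?M" unfolding M using s by (intro mult_right_mono) auto
      finally have "s * m + l < ?M" .
      from stage_digit_word[OF this, of x] show ?thesis
        by (simp add: M algebra_simps)
    qed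
    then show ?thesis by (simp only: map_eq_iff_nth[OF v]) simp
  qed
  have "(\<Sum>t<period i div m. of_bool (map (stage_digit i) [t * m..<(t + 1) * m] = v)) =
      (\<Sum>x::nat<2 ^ ?M. \<Sum>s<c * b. of_bool (\<forall>l<m. v ! l = (mask (s * m + l) \<and> bit x (s * m + l))) :: real)"
    unfolding \<tau> by (subst sum_lessThan_mult) (intro sum.cong refl, simp only: block lessThan_iff)
  also have "\<dots> = (\<Sum>s<c * b. 2 ^ ?M * block_weight mask m s v)"
  proof (subst sum.swap, rule sum.cong)
    fix s
    assume "s \<in> {..<c * b}"
    then have "Suc s * m \<le> ?M" unfolding M by (intro mult_right_mono) auto
    then show "(\<Sum>x::nat<2 ^ ?M. of_bool (\<forall>l<m. v ! l = (mask (s * m + l) \<and> bit x (s * m + l)))) =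
        2 ^ ?M * block_weight mask m s v"
      by (intro sum_bits_window v) simp
  qed simp
  also have "\<dots> = 2 ^ ?M * (c * (\<Sum>j<b. block_weight mask m j v))"
    by (simp add: sum_lessThan_mult block_weight_mask_periodic flip: sum_distrib_left)
  also have "\<dots> = real (period i div m) * limit_frequency m v"
    using b_pos by (simp add: \<tau> limit_frequency_def)
  finally show ?thesis .
qed

lemma limit_frequency_bounds:
  assumes "v \<in> binary_words m"
  shows "0 \<le> limit_frequency m v" "limit_frequency m v \<le> 1"
proof -
  have "block_weight mask m j v \<le> 1" for j
    using member_le_sum[of v "binary_words m" "block_weight mask m j"] assms
    by (simp add: block_weight_nonneg sum_block_weight)
  then have "(\<Sum>j<b. block_weight mask m j v) \<le> (\<Sum>j<b. 1)"
    by (intro sum_mono) simp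
  then show "limit_frequency m v \<le> 1"
    using b_pos by (simp add: limit_frequency_def)
  show "0 \<le> limit_frequency m v"
    by (simp add: limit_frequency_def sum_nonneg block_weight_nonneg)
qed

lemma block_frequency_digits_tendsto:
  assumes m: "0 < m" and v: "v \<in> binary_words m"
  shows "(\<lambda>n. block_frequency m digits n v) \<longlonglongrightarrow> limit_frequency m v"
proof -
  have len: "length v = m" using v by (simp add: binary_words_def)
  have "block_frequency m digits n v =
      (\<Sum>t<n. of_bool (map digits [t * m..<(t + 1) * m] = v)) / n" for n
  proof -
    have "{..<n} \<inter> {t. map digits [t * m..<(t + 1) * m] = v} =
        {t. t < n \<and> map digits [t * m..<(t + 1) * m] = v}" by auto
    then show ?thesis by (simp add: block_frequency_def sum_of_bool_eq)
  qed
  moreover have "(\<lambda>n. (\<Sum>t<n. of_bool (map digits [t * m..<(t + 1) * m] = v)) / real n)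
      \<longlonglongrightarrow> limit_frequency m v"
  \<comment> \<open>Time is counted in blocks of length \<open>m\<close>. From stage
    \<open>m\<close> on, \<open>m\<close> divides \<open>fact i\<close>, hence the period and both
    stage boundaries.\<close>
  proof (rule staged_average_tendsto[where ?i0.0 = m and l = "\<lambda>i. stage_start i div m"
        and \<tau> = "\<lambda>i. period i div m"
        and c = "\<lambda>i t. of_bool (map (stage_digit i) [t * m..<(t + 1) * m] = v)"])
    fix i
    assume i: "m \<le> i"
    have "m dvd fact i" using m i by (intro dvd_fact) auto
    then have m_T: "m dvd period i" by (simp add: period_def word_length_def)
    then obtain c where c: "period i = m * c" by (auto simp: dvd_def)
    have "period i dvd stage_start i" by (rule period_dvd_start)
    then obtain l where l: "stage_start i = m * (c * l)" by (metis dvdE c mult.assoc)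
    have "period i dvd stage_start (Suc i)" by (rule period_dvd_start_Suc)
    then obtain l' where l': "stage_start (Suc i) = m * (c * l')"
      by (metis dvdE c mult.assoc)
    show "stage_start i div m < stage_start (Suc i) div m"
      using stage_start_less[of i] m unfolding l l' by simp
    show "period i div m dvd stage_start i div m" "period i div m dvd stage_start (Suc i) div m"
      using m unfolding l l' c by simp_all
    show "period i div m > 0" using period_pos[of i] m unfolding c by simp
    show "i * (period i div m) \<le> stage_start i div m"
      using mult_period_le_start[of i] m unfolding l c by (simp add: mult.left_commute)
    show "(\<Sum>t<period i div m. of_bool (map (stage_digit i) [t * m..<(t + 1) * m] = v)) =
        real (period i div m) * limit_frequency m v"
      by (rule stage_block_average[OF m i len])
    fix t
    have "stage_digit i ((t + c) * m + k) = stage_digit i (t * m + k)" for k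
      using stage_digit_periodic[of i "t * m + k"] by (simp add: c algebra_simps)
    then show "of_bool (map (stage_digit i) [(t + period i div m) * m..<(t + period i div m + 1) * m] = v) =
        (of_bool (map (stage_digit i) [t * m..<(t + 1) * m] = v) :: real)"
      using m by (simp only: map_eq_iff_nth[OF len]) (simp add: c)
    show "\<bar>of_bool (map (stage_digit i) [t * m..<(t + 1) * m] = v) - limit_frequency m v\<bar> \<le> 1"
      using limit_frequency_bounds[OF v] by (auto simp: of_bool_def)
    assume t: "stage_start i div m \<le> t" "t < stage_start (Suc i) div m"
    then have t: "c * l \<le> t" "Suc t \<le> c * l'"
      using m unfolding l l' by simp_all
    \<comment> \<open>Both boundaries being multiples of \<open>m\<close>, the whole block lies in
      stage \<open>i\<close>.\<close>
    have "digits (t * m + k) = stage_digit i (t * m + k)" if "k < m" for k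
    proof (rule digits_stage)
      have "c * l * m \<le> t * m" using t by (intro mult_right_mono) auto
      moreover have "stage_start i = c * l * m" by (simp add: l mult_ac)
      ultimately show "stage_start i \<le> t * m + k" by linarith
      have "Suc t * m \<le> c * l' * m" using t by (intro mult_right_mono) auto
      then show "t * m + k < stage_start (Suc i)"
        using that unfolding l' by (simp add: mult_ac)
    qed
    then show "of_bool (map digits [t * m..<(t + 1) * m] = v) =
        (of_bool (map (stage_digit i) [t * m..<(t + 1) * m] = v) :: real)"
      by (simp only: map_eq_iff_nth[OF len]) simp
  qed
  ultimately show ?thesis by simp
qed

text \<open>The blocks \<open>j < b\<close> tile \<open>{..<b * m}\<close>, which consists of
  \<open>m\<close> mask periods with \<open>a\<close> free positions each.\<close>

lemma sum_mask_density: "(\<Sum>j<b. real (card {l. l < m \<and> mask (j * m + l)})) = a * m"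
proof -
  have card_eq: "real (card {l. l < n \<and> P l}) = (\<Sum>l<n. of_bool (P l))" for n and P :: "nat \<Rightarrow> bool"
  proof -
    have "{..<n} \<inter> {l. P l} = {l. l < n \<and> P l}" by auto
    then show ?thesis by (simp add: sum_of_bool_eq)
  qed
  have "(\<Sum>j<b. real (card {l. l < m \<and> mask (j * m + l)})) = (\<Sum>k<b * m. of_bool (mask k))"
    by (simp add: card_eq sum_lessThan_mult)
  also have "\<dots> = (\<Sum>x<m. \<Sum>k<b. of_bool (mask k))"
    by (subst mult.commute) (simp add: sum_lessThan_mult mask_add_mult)
  also have "(\<Sum>k<b. of_bool (mask k)) = real (card {k. k < b \<and> mask k})"
    by (simp add: card_eq)
  also have "{k. k < b \<and> mask k} = {..<a}"
    using a_le by (auto simp: mask_def)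
  finally show ?thesis by (simp add: mult.commute)
qed

lemma fs_dim_seq_digits: "fs_dim_seq digits = ereal (a / b)"
proof -
  have entropy: "lower_block_entropy m digits =
      ereal (shannon_entropy (binary_words m) (limit_frequency m) / m)" if "0 < m" for m
    by (rule lower_block_entropy_limit[OF block_frequency_digits_tendsto[OF that]])
  have lower: "ereal (a / b) \<le> lower_block_entropy m digits" if m: "0 < m" for m
  proof -
    have "a * m / b = (\<Sum>j<b. shannon_entropy (binary_words m) (block_weight mask m j)) / b"
      by (simp only: entropy_block_weight sum_mask_density)
    also have "\<dots> \<le> shannon_entropy (binary_words m) (limit_frequency m)"
      unfolding limit_frequency_def
      by (rule entropy_mixture_ge) (simp_all add: block_weight_nonneg sum_block_weight b_pos)
    finally show ?thesis
      using m b_pos by (simp add: entropy field_simps)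
  qed
  \<comment> \<open>Blocks of length \<open>b\<close> all start in phase 0, so the mixture is
    trivial and the concavity bound becomes an equality.\<close>
  have "limit_frequency b = block_weight mask b 0"
  proof
    fix v
    have "(\<Sum>j<b. block_weight mask b j v) = (\<Sum>j<b. block_weight mask b 0 v)"
      by (simp add: block_weight_def mask_add_mult mask_add_mult[of 0, simplified])
    then show "limit_frequency b v = block_weight mask b 0 v"
      using b_pos by (simp add: limit_frequency_def)
  qed
  moreover have "{l. l < b \<and> mask (0 * b + l)} = {..<a}"
    using a_le by (auto simp: mask_def)
  ultimately have upper: "lower_block_entropy b digits = ereal (a / b)"
    using entropy[OF b_pos] by (simp only: entropy_block_weight card_lessThan)
  show ?thesis
    unfolding fs_dim_seq_def
  proof (rule antisym)
    show "(INF m\<in>{1..}. lower_block_entropy m digits) \<le> ereal (a / b)"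
      using b_pos by (intro INF_lower2[of b]) (auto simp: upper)
    show "ereal (a / b) \<le> (INF m\<in>{1..}. lower_block_entropy m digits)"
      using lower by (intro INF_greatest) auto
  qed
qed

lemma ex_liouville_number: "\<exists>\<alpha>\<in>{0..1}. liouville_number \<alpha> \<and> fs_dim \<alpha> = ereal (a / b)"
  using liouville_number_digits fs_dim_seq_digits bval_nonneg[of digits] bval_le_1[of digits]
    binary_digits_bval[OF infinitely_many_zeros]
  by (intro bexI[of _ "bval digits"]) (auto simp: fs_dim_def)

end

section \<open>Dimension zero\<close>

text \<open>A separate construction, since an empty mask would yield only zeros. As index
  \<open>k\<close> has weight \<open>1 / 2 ^ (k + 1)\<close>, the value is half the base 2 analogue
  of Liouville's constant.\<close>

definition factorial_digits :: "nat \<Rightarrow> bool" where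
  "factorial_digits k \<longleftrightarrow> k \<in> range fact"

lemma factorial_digits_gap:
  assumes "fact n < k" "k < fact (Suc n)"
  shows "\<not> factorial_digits k"
proof
  assume "factorial_digits k"
  then obtain j where j: "k = fact j" by (auto simp: factorial_digits_def)
  have "j \<le> n \<or> Suc n \<le> j" by auto
  then have "fact j \<le> (fact n :: nat) \<or> fact (Suc n) \<le> (fact j :: nat)"
    using fact_mono by blast
  then show False using assms j by auto
qed

lemma infinitely_many_factorial_digits: "\<exists>\<^sub>\<infinity>k. factorial_digits k"
  unfolding INFM_nat_le
proof
  fix n
  show "\<exists>k\<ge>n. factorial_digits k"
    using fact_ge_self[of n] by (auto simp: factorial_digits_def)
qed

text \<open>The gap after \<open>fact (l + 2)\<close> contains
  \<open>(l + 2) * fact (l + 2) - 1\<close> zeros, which is at least \<open>l\<close>.\<close>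

lemma factorial_digits_zero_run: "j < l \<Longrightarrow> \<not> factorial_digits (fact (l + 2) + 1 + j)"
  using fact_ge_self[of "l + 2"] by (intro factorial_digits_gap[of "l + 2"]) (simp_all add: fact_Suc del: fact_numeral)

lemma infinitely_many_factorial_zeros: "\<exists>\<^sub>\<infinity>k. \<not> factorial_digits k"
  unfolding INFM_nat_le
proof
  fix n
  have "n \<le> fact (Suc n + 2) + 1 + 0" using fact_ge_self[of "Suc n + 2"] by linarith
  then show "\<exists>k\<ge>n. \<not> factorial_digits k"
    using factorial_digits_zero_run[of 0 "Suc n"] by blast
qed

lemma liouville_number_factorial: "liouville_number (bval factorial_digits)"
proof (rule liouville_number_bval)
  show "bval factorial_digits \<notin> \<rat>"
    using factorial_digits_zero_run
    by (intro bval_irrational infinitely_many_factorial_digits) blast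
  fix n
  have "n + 2 \<le> fact (n + 2)" by (rule fact_ge_self)
  \<comment> \<open>Truncation after \<open>fact (n + 2)\<close> corresponds to \<open>T = 1\<close>
    and \<open>P\<close> constantly zero. The required gap reduces to 2n \<le> 3
    \<open>fact (n + 2)\<close>.\<close>
  moreover have "fact (Suc (n + 2)) = n * fact (n + 2) + 3 * fact (n + 2)"
    by (simp only: fact_Suc) simp
  ultimately have "n \<le> fact (n + 2) + 1" "n * (fact (n + 2) + 1 + 1) \<le> fact (Suc (n + 2))"
    by (simp_all only: distrib_left)
  then show "\<exists>A T E P. n \<le> A \<and> 0 < T \<and> n * (A + T) \<le> E \<and>
      (\<forall>k. P (k + T) = P k) \<and> (\<forall>k. A \<le> k \<and> k < E \<longrightarrow> factorial_digits k = P k)"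
    using factorial_digits_gap[of "n + 2"]
    by (intro exI[of _ "fact (n + 2) + 1"] exI[of _ 1] exI[of _ "fact (Suc (n + 2))"]
        exI[of _ "\<lambda>_. False"]) (simp del: fact_Suc)
qed (rule infinitely_many_factorial_digits)

text \<open>A crude bound that still gives density zero: \<open>fact (Suc j) < n\<close> implies j^2
  \<le> n, so few indices are possible.\<close>

lemma card_factorials_le: "real (card {t. t < n \<and> factorial_digits t}) \<le> sqrt n + 2"
proof -
  let ?s = "nat \<lfloor>sqrt n\<rfloor>"
  have le: "i \<le> Suc ?s" if "fact i < n" for i
  proof (cases i)
    case (Suc j)
    have "j * j \<le> Suc j * fact j"
      using fact_ge_self[of j] by (intro mult_mono) auto
    also have "\<dots> \<le> n" using that by (simp add: Suc)
    finally have "real j ^ 2 \<le> real n" by (simp add: power2_eq_square flip: of_nat_mult)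
    then have "real j \<le> sqrt n" by (rule real_le_rsqrt)
    then show ?thesis by (simp add: Suc le_nat_floor)
  qed simp
  have "{t. t < n \<and> factorial_digits t} \<subseteq> fact ` {..Suc ?s}"
    using le by (auto simp: factorial_digits_def)
  then have "card {t. t < n \<and> factorial_digits t} \<le> card {..Suc ?s}"
    by (intro surj_card_le) auto
  then have "card {t. t < n \<and> factorial_digits t} \<le> ?s + 2" by simp
  then have "real (card {t. t < n \<and> factorial_digits t}) \<le> real (?s + 2)"
    by (simp only: of_nat_le_iff)
  also have "\<dots> = real ?s + 2" by (simp only: of_nat_add of_nat_numeral)
  also have "\<dots> \<le> sqrt n + 2" by (intro add_right_mono of_nat_floor) simp
  finally show ?thesis .
qed

lemma fs_dim_seq_factorial_digits: "fs_dim_seq factorial_digits = 0"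
proof -
  let ?f = "\<lambda>n. real (card {t. t < n \<and> factorial_digits t}) / n"
  have f: "?f \<longlonglongrightarrow> 0"
  proof (rule tendsto_sandwich[OF _ _ tendsto_const])
    show "\<forall>\<^sub>F n in sequentially. ?f n \<le> (sqrt n + 2) / n"
      by (intro always_eventually allI divide_right_mono card_factorials_le) simp
    show "(\<lambda>n. (sqrt (real n) + 2) / real n) \<longlonglongrightarrow> 0"
      by real_asymp
  qed simp
  \<comment> \<open>Block length 1 suffices: the limit is the point mass at \<open>[False]\<close>,
    of entropy 0, and all lower block entropies are nonnegative.\<close>
  have "(\<lambda>n. block_frequency 1 factorial_digits n v) \<longlonglongrightarrow> of_bool (v = [False])"
    if v: "v \<in> binary_words 1" for v
  proof -
    consider "v = [True]" | "v = [False]"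
      using v by (auto simp: binary_words_Suc binary_words_0)
    then show ?thesis
    proof cases
      case 1
      then show ?thesis using f by (simp add: block_frequency_def)
    next
      case 2
      have "block_frequency 1 factorial_digits n v = 1 - ?f n" if "n > 0" for n
      proof -
        let ?A = "{t. t < n \<and> factorial_digits t}" and ?B = "{t. t < n \<and> \<not> factorial_digits t}"
        have "card {..<n} = card (?A \<union> ?B)"
          by (rule arg_cong) auto
        also have "\<dots> = card ?A + card ?B"
          by (rule card_Un_disjoint) auto
        finally have "real n = real (card ?A) + real (card ?B)"
          by (simp only: card_lessThan of_nat_add)
        then show ?thesis
          using that by (simp add: block_frequency_def 2 field_simps)
      qed
      then have "\<forall>\<^sub>F n in sequentially. 1 - ?f n = block_frequency 1 factorial_digits n v"
        by (intro eventually_sequentiallyI[of 1]) simp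
      moreover have "(\<lambda>n. 1 - ?f n) \<longlonglongrightarrow> 1 - 0"
        using f by (intro tendsto_intros)
      ultimately show ?thesis
        using Lim_transform_eventually by (fastforce simp: 2)
    qed
  qed
  from lower_block_entropy_limit[OF this]
  have "lower_block_entropy 1 factorial_digits =
      ereal (shannon_entropy (binary_words 1) (\<lambda>v. of_bool (v = [False])))" by simp
  also have "shannon_entropy (binary_words 1) (\<lambda>v. of_bool (v = [False])) = 0"
    unfolding shannon_entropy_def by (rule sum.neutral) auto
  finally have "lower_block_entropy 1 factorial_digits = 0" by simp
  then show ?thesis
    unfolding fs_dim_seq_def
    by (intro antisym INF_lower2[of 1] INF_greatest lower_block_entropy_nonneg) auto
qed

theorem mainTheorem4:
  fixes r :: real
  assumes "r \<in> \<rat>" and "0 \<le> r" and "r \<le> 1"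
  shows "\<exists>\<alpha>\<in>{0..1}. liouville_number \<alpha> \<and> fs_dim \<alpha> = ereal r"
proof (cases "r = 0")
  case True
  then show ?thesis
    using liouville_number_factorial fs_dim_seq_factorial_digits
      bval_nonneg[of factorial_digits] bval_le_1[of factorial_digits]
      binary_digits_bval[OF infinitely_many_factorial_zeros]
    by (intro bexI[of _ "bval factorial_digits"]) (auto simp: fs_dim_def)
next
  case False
  obtain a b :: nat where b: "b \<noteq> 0" and "\<bar>r\<bar> = a / b"
    using assms(1) by (rule Rats_abs_nat_div_natE)
  then have r: "r = a / b" using assms(2) by simp
  interpret masked_stages a b
  proof
    show "0 < a" using False r by (intro gr0I) auto
    show "a \<le> b" using assms(3) b by (simp add: r)
  qed
  show ?thesis unfolding r by (rule ex_liouville_number)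
qed

end
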